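(* Let $R$ be a commutative ring with identity. Then: (1) If $R$ is a coherent ring, then $R$ is a weakly coherent ring. (2) Assume that $R$ contains a non-unit regular element (that is, $R$ is not a total ring of quotients). Then $R$ is a coherent ring if and only if $R$ is a weakly coherent ring.
   Context: All rings are commutative with identity. A regular element of a ring is a non-zerodivisor. A ring is a total ring of quotients if each of its regular elements is a unit. A ring $R$ is coherent if every finitely generated ideal of $R$ is finitely presented as an $R$-module. A ring $R$ is called weakly coherent (also "weak coherent") if for all proper ideals $I \subseteq J$ of $R$ such that $I$ is finitely generated and $J$ is finitely presented (as $R$-modules), the ideal $I$ is finitely presented. *)

theory Defs
  imports "HOL-Algebra.Module" "HOL-Algebra.Ideal" "HOL-Library.FuncSet"
begin

definition module_hom ::
    "[('a, 'm) ring_scheme, ('a, 'b, 'p) module_scheme, ('a, 'c, 'q) module_scheme] \<Rightarrow> ('b \<Rightarrow> 'c) set"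
  where "module_hom R M N =
    {h. h \<in> carrier M \<rightarrow> carrier N \<and>
        (\<forall>x\<in>carrier M. \<forall>y\<in>carrier M. h (x \<oplus>\<^bsub>M\<^esub> y) = h x \<oplus>\<^bsub>N\<^esub> h y) \<and>
        (\<forall>a\<in>carrier R. \<forall>x\<in>carrier M. h (a \<odot>\<^bsub>M\<^esub> x) = a \<odot>\<^bsub>N\<^esub> h x)}"

definition module_kernel ::
    "[('a, 'b, 'p) module_scheme, ('a, 'c, 'q) module_scheme, 'b \<Rightarrow> 'c] \<Rightarrow> 'b set"
  where "module_kernel M N h = {x \<in> carrier M. h x = \<zero>\<^bsub>N\<^esub>}"

definition gen_submodule ::
    "[('a, 'm) ring_scheme, ('a, 'b, 'p) module_scheme, 'b set] \<Rightarrow> 'b set"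
  where "gen_submodule R M S = \<Inter>{H. submodule H R M \<and> S \<subseteq> H}"

definition fin_generated :: "[('a, 'm) ring_scheme, ('a, 'b, 'p) module_scheme] \<Rightarrow> bool"
  where "fin_generated R M \<longleftrightarrow>
    (\<exists>S. finite S \<and> S \<subseteq> carrier M \<and> gen_submodule R M S = carrier M)"

text \<open>The free module \<open>R\<^sup>n\<close>: its elements are functions on \<open>{..<n}\<close>, extended by
  \<open>undefined\<close> outside. The ring multiplication and unit that every module record carries
  play no role in the notion of a module and are left unspecified.\<close>

definition free_module :: "('a, 'm) ring_scheme \<Rightarrow> nat \<Rightarrow> ('a, nat \<Rightarrow> 'a) module"
  where "free_module R n =
    \<lparr>carrier = (\<Pi>\<^sub>E i\<in>{..<n}. carrier R),
     monoid.mult = undefined,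
     one = undefined,
     zero = (\<lambda>i\<in>{..<n}. \<zero>\<^bsub>R\<^esub>),
     add = (\<lambda>x y. \<lambda>i\<in>{..<n}. x i \<oplus>\<^bsub>R\<^esub> y i),
     smult = (\<lambda>a x. \<lambda>i\<in>{..<n}. a \<otimes>\<^bsub>R\<^esub> x i)\<rparr>"

definition fin_presented :: "[('a, 'm) ring_scheme, ('a, 'b, 'p) module_scheme] \<Rightarrow> bool"
  where "fin_presented R M \<longleftrightarrow>
    (\<exists>n. \<exists>h \<in> module_hom R (free_module R n) M.
       h ` carrier (free_module R n) = carrier M \<and>
       fin_generated R ((free_module R n)\<lparr>carrier := module_kernel (free_module R n) M h\<rparr>))"

definition self_module :: "('a, 'm) ring_scheme \<Rightarrow> ('a, 'a) module"
  where "self_module R =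
    \<lparr>carrier = carrier R, monoid.mult = monoid.mult R, one = one R, zero = zero R, add = add R,
     smult = monoid.mult R\<rparr>"

definition ideal_module :: "('a, 'm) ring_scheme \<Rightarrow> 'a set \<Rightarrow> ('a, 'a) module"
  where "ideal_module R I = (self_module R)\<lparr>carrier := I\<rparr>"

definition regular_element :: "('a, 'm) ring_scheme \<Rightarrow> 'a \<Rightarrow> bool"
  where "regular_element R r \<longleftrightarrow>
    r \<in> carrier R \<and> (\<forall>x\<in>carrier R. r \<otimes>\<^bsub>R\<^esub> x = \<zero>\<^bsub>R\<^esub> \<longrightarrow> x = \<zero>\<^bsub>R\<^esub>)"

locale total_quotient_ring = cring +
  assumes regular_unit: "regular_element R r \<Longrightarrow> r \<in> Units R"

locale coherent_ring = cring +
  assumes fin_generated_imp_fin_presented: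
    "\<lbrakk>ideal I R; fin_generated R (ideal_module R I)\<rbrakk> \<Longrightarrow> fin_presented R (ideal_module R I)"

locale weakly_coherent_ring = cring +
  assumes fin_presented_below:
    "\<lbrakk>ideal I R; ideal J R; I \<noteq> carrier R; J \<noteq> carrier R; I \<subseteq> J;
      fin_generated R (ideal_module R I); fin_presented R (ideal_module R J)\<rbrakk>
     \<Longrightarrow> fin_presented R (ideal_module R I)"

lemma (in cring) not_total_quotient_ring_iff:
  "\<not> total_quotient_ring R \<longleftrightarrow> (\<exists>r. regular_element R r \<and> r \<notin> Units R)"
  by (auto simp: total_quotient_ring_def total_quotient_ring_axioms_def is_cring)

lemma (in cring) self_module_is_module: "module R (self_module R)"
proof -
  have "abelian_group (self_module R)"
  proof (rule abelian_groupI)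
    fix x assume "x \<in> carrier (self_module R)"
    then show "\<exists>y\<in>carrier (self_module R). y \<oplus>\<^bsub>self_module R\<^esub> x = \<zero>\<^bsub>self_module R\<^esub>"
      by (intro bexI[of _ "\<ominus> x"]) (simp_all add: self_module_def l_neg)
  qed (simp_all add: self_module_def a_ac)
  then show ?thesis
    by (intro moduleI) (simp_all add: self_module_def is_cring l_distr r_distr m_assoc)
qed

lemma (in cring) free_module_is_module: "module R (free_module R n)"
proof -
  have ext: "x = y" if "x \<in> extensional {..<n}" "y \<in> extensional {..<n}"
    "\<And>i. i < n \<Longrightarrow> x i = y i" for x y :: "nat \<Rightarrow> 'a"
    using that by (metis extensionalityI lessThan_iff)
  have abelian: "abelian_group (free_module R n)"
  proof (rule abelian_groupI)
    fix x assume x: "x \<in> carrier (free_module R n)"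
    then have "(\<lambda>i\<in>{..<n}. \<ominus> x i) \<in> carrier (free_module R n)"
      by (auto simp: free_module_def)
    moreover have "(\<lambda>i\<in>{..<n}. \<ominus> x i) \<oplus>\<^bsub>free_module R n\<^esub> x = \<zero>\<^bsub>free_module R n\<^esub>"
      using x by (auto simp: free_module_def fun_eq_iff PiE_iff l_neg)
    ultimately show "\<exists>y\<in>carrier (free_module R n). y \<oplus>\<^bsub>free_module R n\<^esub> x = \<zero>\<^bsub>free_module R n\<^esub>"
      by blast
  qed (auto simp: free_module_def PiE_iff a_ac intro: ext)
  show ?thesis
    by (intro moduleI is_cring abelian)
       (auto simp: free_module_def PiE_iff l_distr r_distr m_assoc intro: ext)
qed

lemma (in cring) submodule_self_module_iff: "submodule I R (self_module R) \<longleftrightarrow> ideal I R"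
proof
  interpret M: module R "self_module R" by (rule self_module_is_module)
  have inv: "\<ominus>\<^bsub>self_module R\<^esub> x = \<ominus> x" for x
    by (simp add: a_inv_def self_module_def m_inv_def)
  {
    assume I: "submodule I R (self_module R)"
    have sub: "subgroup I (add_monoid R)"
      using submodule.axioms(1)[OF I] by (simp add: self_module_def subgroup_def m_inv_def)
    have cl: "x \<otimes> a \<in> I" if "a \<in> I" "x \<in> carrier R" for a x
      using submodule.smult_closed[OF I that(2,1)] by (simp add: self_module_def)
    show "ideal I R"
    proof (rule idealI)
      show "ring R" ..
      show "subgroup I (add_monoid R)" by (rule sub)
      fix a x assume ax: "a \<in> I" "x \<in> carrier R"
      then show "x \<otimes> a \<in> I" by (rule cl)
      with ax sub show "a \<otimes> x \<in> I"
        by (metis m_comm partial_object.select_convs(1) subgroup.mem_carrier)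
    qed
  }
  assume "ideal I R"
  then interpret ideal I R .
  show "submodule I R (self_module R)"
    by (rule M.submoduleI) (use a_subset in \<open>simp_all add: inv, simp_all add: self_module_def I_l_closed\<close>)
qed

end

theory Submission
  imports Defs
begin

text \<open>Let \<open>r\<close> be a regular non-unit and \<open>I\<close> a finitely generated ideal. Multiplication by \<open>r\<close>
  is an isomorphism of modules \<open>I \<cong> rI\<close> and \<open>R \<cong> rR\<close>. Hence \<open>rI \<subseteq> rR\<close> are proper ideals with
  \<open>rI\<close> finitely generated and \<open>rR\<close> finitely presented, so weak coherence makes \<open>rI\<close>, and
  therefore \<open>I\<close>, finitely presented.\<close>

section \<open>Module homomorphisms and their inverses\<close>

lemma module_hom_closed:
  "\<lbrakk>h \<in> module_hom R M N; x \<in> carrier M\<rbrakk> \<Longrightarrow> h x \<in> carrier N"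
  and module_hom_add:
  "\<lbrakk>h \<in> module_hom R M N; x \<in> carrier M; y \<in> carrier M\<rbrakk>
     \<Longrightarrow> h (x \<oplus>\<^bsub>M\<^esub> y) = h x \<oplus>\<^bsub>N\<^esub> h y"
  and module_hom_smult:
  "\<lbrakk>h \<in> module_hom R M N; a \<in> carrier R; x \<in> carrier M\<rbrakk>
     \<Longrightarrow> h (a \<odot>\<^bsub>M\<^esub> x) = a \<odot>\<^bsub>N\<^esub> h x"
  by (auto simp: module_hom_def)

lemma module_hom_zero:
  assumes "module R M" "module R N" "h \<in> module_hom R M N"
  shows "h \<zero>\<^bsub>M\<^esub> = \<zero>\<^bsub>N\<^esub>"
proof -
  interpret M: module R M by fact
  interpret N: module R N by fact
  \<comment> \<open>Writing zero as the scalar zero times itself lets linearity over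
    \<open>R\<close> do the work.\<close>
  have "h \<zero>\<^bsub>M\<^esub> = h (\<zero>\<^bsub>R\<^esub> \<odot>\<^bsub>M\<^esub> \<zero>\<^bsub>M\<^esub>)" by simp
  also have "\<dots> = \<zero>\<^bsub>R\<^esub> \<odot>\<^bsub>N\<^esub> h \<zero>\<^bsub>M\<^esub>"
    using assms(3) by (rule module_hom_smult) simp_all
  finally show ?thesis
    using module_hom_closed[OF assms(3)] by simp
qed

lemma module_hom_neg:
  assumes "module R M" "module R N" "h \<in> module_hom R M N" "x \<in> carrier M"
  shows "h (\<ominus>\<^bsub>M\<^esub> x) = \<ominus>\<^bsub>N\<^esub> h x"
proof -
  interpret M: module R M by fact
  interpret N: module R N by fact
  have "h (\<ominus>\<^bsub>M\<^esub> x) \<oplus>\<^bsub>N\<^esub> h x = h (\<ominus>\<^bsub>M\<^esub> x \<oplus>\<^bsub>M\<^esub> x)"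
    using assms by (simp add: module_hom_add)
  also have "\<dots> = \<zero>\<^bsub>N\<^esub>"
    using assms by (simp add: M.l_neg module_hom_zero)
  finally show ?thesis
    using assms by (simp add: N.minus_equality module_hom_closed)
qed

lemma module_hom_compose:
  "\<lbrakk>g \<in> module_hom R M N; h \<in> module_hom R N P\<rbrakk> \<Longrightarrow> h \<circ> g \<in> module_hom R M P"
  by (auto simp: module_hom_def Pi_iff)

text \<open>Injectivity makes the preimage of a sum or of a scalar multiple unique, so it is enough
  to exhibit one. This allows the way back from \<open>rI\<close> to \<open>I\<close>.\<close>

lemma inv_into_module_hom:
  assumes "module R M" and h: "h \<in> module_hom R M N"
    and bij: "bij_betw h (carrier M) (carrier N)"
  shows "inv_into (carrier M) h \<in> module_hom R N M"
proof -
  interpret M: module R M by fact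
  let ?g = "inv_into (carrier M) h"
  have g: "?g y \<in> carrier M" "h (?g y) = y" if "y \<in> carrier N" for y
    using that bij by (auto simp: bij_betw_def inv_into_into f_inv_into_f)
  have gh: "?g y = x" if "x \<in> carrier M" "y = h x" for x y
    using that bij by (auto simp: bij_betw_def)
  have "?g (x \<oplus>\<^bsub>N\<^esub> y) = ?g x \<oplus>\<^bsub>M\<^esub> ?g y" if "x \<in> carrier N" "y \<in> carrier N" for x y
    using that by (intro gh) (simp_all add: g module_hom_add[OF h])
  moreover have "?g (a \<odot>\<^bsub>N\<^esub> x) = a \<odot>\<^bsub>M\<^esub> ?g x" if "a \<in> carrier R" "x \<in> carrier N" for a x
    using that by (intro gh) (simp_all add: g module_hom_smult[OF h])
  ultimately show ?thesis
    by (simp add: module_hom_def g(1))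
qed

section \<open>Transfer of finite generation and finite presentation\<close>

lemma submodule_vimage:
  assumes M: "module R M" and N: "module R N" and h: "h \<in> module_hom R M N"
    and H: "submodule H R N"
  shows "submodule {x \<in> carrier M. h x \<in> H} R M"
proof -
  interpret M: module R M by fact
  interpret N: module R N by fact
  \<comment> \<open>Zero is the identity of the additive subgroup underlying
    \<open>H\<close>.\<close>
  have "\<zero>\<^bsub>N\<^esub> \<in> H"
    using subgroup.one_closed[OF submodule.axioms(1)[OF H]] by simp
  then show ?thesis
    by (intro M.submoduleI)
      (use N.submoduleE[OF H] in
        \<open>auto simp: module_hom_zero[OF M N h] module_hom_neg[OF M N h]
           module_hom_add[OF h] module_hom_smult[OF h]\<close>)
qed

lemma fin_generated_surj:
  assumes M: "module R M" and N: "module R N" and h: "h \<in> module_hom R M N"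
    and surj: "h ` carrier M = carrier N" and fg: "fin_generated R M"
  shows "fin_generated R N"
proof -
  interpret N: module R N by fact
  obtain S where S: "finite S" "S \<subseteq> carrier M" "gen_submodule R M S = carrier M"
    using fg by (auto simp: fin_generated_def)
  have "carrier N \<subseteq> H" if H: "submodule H R N" "h ` S \<subseteq> H" for H
  proof -
    have "S \<subseteq> {x \<in> carrier M. h x \<in> H}"
      using S(2) H(2) by auto
    then have "gen_submodule R M S \<subseteq> {x \<in> carrier M. h x \<in> H}"
      using submodule_vimage[OF M N h H(1)] by (auto simp: gen_submodule_def)
    then have "h ` carrier M \<subseteq> H"
      by (auto simp: S(3))
    then show ?thesis
      by (simp add: surj)
  qed
  then have "carrier N \<subseteq> gen_submodule R N (h ` S)"
    by (auto simp: gen_submodule_def)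
  moreover have hS: "h ` S \<subseteq> carrier N"
    using S(2) module_hom_closed[OF h] by auto
  then have "gen_submodule R N (h ` S) \<subseteq> carrier N"
    unfolding gen_submodule_def by (intro Inter_lower) (simp add: N.carrier_is_submodule)
  ultimately show ?thesis
    using S(1) hS unfolding fin_generated_def by (intro exI[of _ "h ` S"]) simp
qed

text \<open>A presentation \<open>g\<close> of \<open>M\<close> is composed with \<open>h\<close>.
  Since \<open>h\<close> is injective, \<open>h \<circ> g\<close> has the same kernel as
  \<open>g\<close>, so finite generation of the kernel carries over unchanged.\<close>

lemma fin_presented_iso:
  assumes M: "module R M" and N: "module R N" and h: "h \<in> module_hom R M N"
    and bij: "bij_betw h (carrier M) (carrier N)" and fp: "fin_presented R M"
  shows "fin_presented R N"
proof -
  interpret M: module R M by fact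
  obtain n g where g: "g \<in> module_hom R (free_module R n) M"
    "g ` carrier (free_module R n) = carrier M"
    and fg: "fin_generated R
      ((free_module R n)\<lparr>carrier := module_kernel (free_module R n) M g\<rparr>)"
    using fp by (auto simp: fin_presented_def)
  have "h y = \<zero>\<^bsub>N\<^esub> \<longleftrightarrow> y = \<zero>\<^bsub>M\<^esub>" if "y \<in> carrier M" for y
    using that bij module_hom_zero[OF M N h] M.zero_closed
    by (metis bij_betw_imp_inj_on inj_onD)
  then have "module_kernel (free_module R n) N (h \<circ> g) = module_kernel (free_module R n) M g"
    using module_hom_closed[OF g(1)] by (auto simp: module_kernel_def)
  moreover have "(h \<circ> g) ` carrier (free_module R n) = carrier N"
    using g(2) bij by (metis image_comp bij_betw_imp_surj_on)
  ultimately show ?thesis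
    using fg module_hom_compose[OF g(1) h] unfolding fin_presented_def by metis
qed

text \<open>The identity map is a presentation whose kernel is zero, generated by
  \<open>{\<zero>}\<close>.\<close>

lemma (in cring) fin_presented_free_module: "fin_presented R (free_module R n)"
proof -
  let ?F = "free_module R n"
  interpret F: module R ?F by (rule free_module_is_module)
  have sub: "submodule {\<zero>\<^bsub>?F\<^esub>} R ?F"
    by (rule F.submoduleI) auto
  then have mod: "module R (?F\<lparr>carrier := {\<zero>\<^bsub>?F\<^esub>}\<rparr>)"
    using F.module_axioms by (rule submodule.submodule_is_module)
  have "gen_submodule R (?F\<lparr>carrier := {\<zero>\<^bsub>?F\<^esub>}\<rparr>) {\<zero>\<^bsub>?F\<^esub>} = {\<zero>\<^bsub>?F\<^esub>}"
    using module.carrier_is_submodule[OF mod] by (auto simp: gen_submodule_def)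
  then have "fin_generated R (?F\<lparr>carrier := {\<zero>\<^bsub>?F\<^esub>}\<rparr>)"
    unfolding fin_generated_def by (intro exI[of _ "{\<zero>\<^bsub>?F\<^esub>}"]) simp
  moreover have "module_kernel ?F ?F (\<lambda>x. x) = {\<zero>\<^bsub>?F\<^esub>}"
    by (auto simp: module_kernel_def)
  moreover have "(\<lambda>x. x) \<in> module_hom R ?F ?F"
    by (simp add: module_hom_def)
  ultimately show ?thesis
    unfolding fin_presented_def by (metis image_ident)
qed

section \<open>Ideals and multiplication by a fixed element\<close>

lemma (in cring) module_ideal_module:
  assumes "ideal I R"
  shows "module R (ideal_module R I)"
  unfolding ideal_module_def
  by (rule submodule.submodule_is_module[OF submodule_self_module_iff[THEN iffD2, OF assms]
        self_module_is_module])

text \<open>Serves for both \<open>rI\<close> and \<open>rR\<close>, the latter by taking the unit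
  ideal for \<open>I\<close>.\<close>

lemma (in cring) ideal_mult_image:
  assumes I: "ideal I R" and r: "r \<in> carrier R"
  shows "ideal ((\<otimes>) r ` I) R"
proof -
  interpret I: ideal I R by fact
  have IR: "x \<in> carrier R" if "x \<in> I" for x
    using that by simp
  have sub: "subgroup ((\<otimes>) r ` I) (add_monoid R)"
  proof (rule add.subgroupI)
    show "(\<otimes>) r ` I \<subseteq> carrier R"
      using r by auto
    show "(\<otimes>) r ` I \<noteq> {}"
      using additive_subgroup.zero_closed[OF I.additive_subgroup_axioms] by blast
    fix a b assume "a \<in> (\<otimes>) r ` I" "b \<in> (\<otimes>) r ` I"
    then obtain x y where xy: "x \<in> I" "y \<in> I" "a = r \<otimes> x" "b = r \<otimes> y"
      by auto
    then have "\<ominus> a = r \<otimes> (\<ominus> x)" "a \<oplus> b = r \<otimes> (x \<oplus> y)"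
      using r by (simp_all add: r_minus r_distr)
    with xy show "\<ominus> a \<in> (\<otimes>) r ` I" "a \<oplus> b \<in> (\<otimes>) r ` I"
      by simp_all
  qed
  have "a \<otimes> x \<in> (\<otimes>) r ` I" if "a \<in> (\<otimes>) r ` I" "x \<in> carrier R" for a x
    using that r by (auto simp: m_assoc I.I_r_closed)
  moreover from this have "x \<otimes> a \<in> (\<otimes>) r ` I" if "a \<in> (\<otimes>) r ` I" "x \<in> carrier R" for a x
    using that r IR by (metis imageE m_closed m_comm)
  ultimately show ?thesis
    using sub by (intro idealI ring_axioms)
qed

lemma (in cring) module_hom_mult:
  assumes I: "ideal I R" and r: "r \<in> carrier R"
  shows "(\<otimes>) r \<in> module_hom R (ideal_module R I) (ideal_module R ((\<otimes>) r ` I))"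
proof -
  interpret I: ideal I R by fact
  show ?thesis
    using r by (auto simp: module_hom_def ideal_module_def self_module_def r_distr m_lcomm)
qed

lemma (in cring) regular_element_inj_on:
  assumes "regular_element R r"
  shows "inj_on ((\<otimes>) r) (carrier R)"
proof (rule inj_onI)
  fix x y assume xy: "x \<in> carrier R" "y \<in> carrier R" "r \<otimes> x = r \<otimes> y"
  have r: "r \<in> carrier R"
    using assms by (simp add: regular_element_def)
  then have "r \<otimes> (x \<ominus> y) = \<zero>"
    using xy by (simp add: minus_eq r_distr r_minus r_neg)
  then have "x \<ominus> y = \<zero>"
    using assms xy by (simp add: regular_element_def)
  then show "x = y"
    using xy minus_equality[of x "\<ominus> y"] by (simp add: minus_eq)
qed

text \<open>Regularity makes \<open>rR\<close> free of rank one: \<open>v\<close> goes to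
  \<open>r \<otimes> v 0\<close>, an isomorphism from \<open>free_module R 1\<close>, whose finite
  presentation is known.\<close>

lemma (in cring) fin_presented_regular_principal:
  assumes reg: "regular_element R r"
  shows "fin_presented R (ideal_module R ((\<otimes>) r ` carrier R))"
proof (rule fin_presented_iso)
  have r: "r \<in> carrier R"
    using reg by (simp add: regular_element_def)
  let ?F = "free_module R 1" and ?J = "ideal_module R ((\<otimes>) r ` carrier R)"
  let ?h = "\<lambda>v :: nat \<Rightarrow> 'a. r \<otimes> v 0"
  show "module R ?F" "fin_presented R ?F"
    by (rule free_module_is_module fin_presented_free_module)+
  show "module R ?J"
    by (intro module_ideal_module ideal_mult_image oneideal r)
  show "?h \<in> module_hom R ?F ?J"
    using r by (auto simp: module_hom_def free_module_def ideal_module_def self_module_def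
        PiE_iff r_distr m_lcomm)
  have "inj_on ?h (carrier ?F)"
  proof (rule inj_onI)
    fix v w assume vw: "v \<in> carrier ?F" "w \<in> carrier ?F" "?h v = ?h w"
    then have "v 0 \<in> carrier R" "w 0 \<in> carrier R"
      by (auto simp: free_module_def PiE_iff)
    then have "v 0 = w 0"
      using vw(3) by (simp add: inj_on_eq_iff[OF regular_element_inj_on[OF reg]])
    \<comment> \<open>Index 0 is the only one below 1, and both functions are
      \<open>undefined\<close> elsewhere.\<close>
    with vw show "v = w"
      by (intro PiE_ext[of v "{..<1}" "\<lambda>_. carrier R" w]) (simp_all add: free_module_def)
  qed
  moreover have "?h ` carrier ?F = carrier ?J"
  proof
    show "?h ` carrier ?F \<subseteq> carrier ?J"
      by (auto simp: free_module_def ideal_module_def)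
    have "r \<otimes> x \<in> ?h ` carrier ?F" if "x \<in> carrier R" for x
      \<comment> \<open>The preimage of \<open>r \<otimes> x\<close> is the one-entry vector with
        entry \<open>x\<close>.\<close>
      using that by (intro image_eqI[of _ _ "\<lambda>i\<in>{..<1}. x"]) (auto simp: free_module_def)
    then show "carrier ?J \<subseteq> ?h ` carrier ?F"
      by (auto simp: ideal_module_def)
  qed
  ultimately show "bij_betw ?h (carrier ?F) (carrier ?J)"
    by (simp add: bij_betw_def)
qed

section \<open>Coherence and weak coherence\<close>

lemma (in coherent_ring) weakly_coherent: "weakly_coherent_ring R"
  by unfold_locales (rule fin_generated_imp_fin_presented)

lemma (in weakly_coherent_ring) coherent:
  assumes reg: "regular_element R r" and nonunit: "r \<notin> Units R"
  shows "coherent_ring R"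
proof unfold_locales
  fix I assume I: "ideal I R" and fg: "fin_generated R (ideal_module R I)"
  have r: "r \<in> carrier R"
    using reg by (simp add: regular_element_def)
  have IR: "I \<subseteq> carrier R"
    using ideal.Icarr[OF I] by blast
  let ?rI = "(\<otimes>) r ` I" and ?rR = "(\<otimes>) r ` carrier R"
  have mods: "module R (ideal_module R I)" "module R (ideal_module R ?rI)"
    using I r by (simp_all add: module_ideal_module ideal_mult_image)
  have hom: "(\<otimes>) r \<in> module_hom R (ideal_module R I) (ideal_module R ?rI)"
    using I r by (rule module_hom_mult)
  have bij: "bij_betw ((\<otimes>) r) (carrier (ideal_module R I)) (carrier (ideal_module R ?rI))"
    using inj_on_subset[OF regular_element_inj_on[OF reg] IR]
    by (simp add: bij_betw_def ideal_module_def)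
  \<comment> \<open>Here the non-unit hypothesis enters: a preimage of one would be an inverse of
    \<open>r\<close>. Both \<open>rR\<close> and the smaller \<open>rI\<close> are therefore proper,
    as weak coherence demands.\<close>
  have "\<one> \<notin> ?rR"
  proof
    assume "\<one> \<in> ?rR"
    then obtain x where "x \<in> carrier R" "r \<otimes> x = \<one>"
      by auto
    then show False
      using nonunit r m_comm by (auto simp: Units_def)
  qed
  moreover have sub: "?rI \<subseteq> ?rR"
    using IR by blast
  ultimately have proper: "?rI \<noteq> carrier R" "?rR \<noteq> carrier R"
    using one_closed by blast+
  \<comment> \<open>Multiplication by \<open>r\<close> carries generators of \<open>I\<close> to
    generators of \<open>rI\<close>.\<close>
  have "fin_generated R (ideal_module R ?rI)"
    by (rule fin_generated_surj[OF mods hom bij_betw_imp_surj_on[OF bij] fg])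
  then have "fin_presented R (ideal_module R ?rI)"
    by (rule fin_presented_below[OF ideal_mult_image[OF I r] ideal_mult_image[OF oneideal r]
          proper sub _ fin_presented_regular_principal[OF reg]])
  \<comment> \<open>The presentation of \<open>rI\<close> is pulled back along division by
    \<open>r\<close>, the inverse isomorphism.\<close>
  then show "fin_presented R (ideal_module R I)"
    by (rule fin_presented_iso[OF mods(2,1) inv_into_module_hom[OF mods(1) hom bij]
          bij_betw_inv_into[OF bij]])
qed

theorem proposition2p2:
  fixes R (structure)
  assumes "cring R"
  shows "(coherent_ring R \<longrightarrow> weakly_coherent_ring R) \<and>
         ((\<exists>r. regular_element R r \<and> r \<notin> Units R) \<longrightarrow>
            (coherent_ring R \<longleftrightarrow> weakly_coherent_ring R))"
  by (meson coherent_ring.weakly_coherent weakly_coherent_ring.coherent)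

end
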